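(* Let $m,\sigma,L_0,L,y_0$ be real numbers with $m>0$, $\sigma>0$, $0<L_0<L$ and $y_0>0$. Let $P$ be the true period of oscillation, i.e. the (least positive) period of the solution $y(t)$ of $$\frac{d^2y}{dt^2}+\left(\frac{2\sigma}{m}\,\frac{\sqrt{L^2+y^2}-L_0}{\sqrt{L^2+y^2}}\right)y=0,\qquad y(0)=y_0,\quad \dot y(0)=0,$$ let $\overline{P}=\dfrac{2\pi}{\sqrt{\frac{2T}{mL}}}$ with $T=\sigma(L-L_0)$ be Rayleigh's approximate period, and let $R:=\dfrac{P-\overline{P}}{P}$. Then $$|R|=\Theta\cdot\frac{L_0}{L-L_0}\cdot\left(\frac{y_0}{2L}\right)^2$$ where $\Theta$ satisfies $$\frac{\frac{1}{2}-\left(\frac{y_0}{2L}\right)^2}{1+\frac{1}{32}\frac{L_0}{L-L_0}}\leq\Theta\leq 1,$$ and in fact $\Theta$ is always strictly greater than this lower bound and always strictly less than $1$.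
   Context: Physical setting: a horizontal elastic wire of natural length $2L_0$ is stretched to length $2L$; a body of mass $m$ is tied to its center and moves on the vertical line through the center, with vertical displacement $y(t)$. Each half of the wire exerts a tension of magnitude $\sigma(\sqrt{L^2+y^2}-L_0)$, where $\sigma$ is the spring constant; there is no gravity and no damping. Newton's law gives the nonlinear differential equation in the claim; the body starts from rest at displacement $y_0$. Rayleigh's approximation replaces the tension by the constant $T=\sigma(L-L_0)$ and the equation by $\ddot y+\frac{2T}{mL}y=0$, which has period $\overline{P}=2\pi/\sqrt{2T/(mL)}$. $R$ is the relative error in the approximation $P\approx\overline{P}$. *)

theory Defs
  imports "HOL-Analysis.Analysis"
begin

text \<open>
  Displacement of a body of mass \<open>m\<close> tied to the centre of a horizontal wire of natural length
  \<open>2 L0\<close>, stretched to length \<open>2 L\<close>, with spring constant \<open>\<sigma>\<close>. The functions \<open>v\<close> and \<open>a\<close> are the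
  velocity and the acceleration, so \<open>y\<close> is required to be twice differentiable on all of \<open>\<real>\<close>.
\<close>

definition wire_motion ::
    "real \<Rightarrow> real \<Rightarrow> real \<Rightarrow> real \<Rightarrow> real \<Rightarrow> (real \<Rightarrow> real) \<Rightarrow> bool" where
  "wire_motion m \<sigma> L0 L y0 y \<longleftrightarrow>
     (\<exists>v a. (\<forall>t. (y has_real_derivative v t) (at t)) \<and>
            (\<forall>t. (v has_real_derivative a t) (at t)) \<and>
            (\<forall>t. a t + (2 * \<sigma> / m * ((sqrt (L\<^sup>2 + (y t)\<^sup>2) - L0) / sqrt (L\<^sup>2 + (y t)\<^sup>2))) * y t = 0) \<and>
            y 0 = y0 \<and> v 0 = 0)"

definition is_period :: "real \<Rightarrow> (real \<Rightarrow> real) \<Rightarrow> bool" where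
  "is_period p y \<longleftrightarrow> 0 < p \<and> (\<forall>t. y (t + p) = y t)"

definition is_least_period :: "real \<Rightarrow> (real \<Rightarrow> real) \<Rightarrow> bool" where
  "is_least_period P y \<longleftrightarrow> is_period P y \<and> (\<forall>p. is_period p y \<longrightarrow> P \<le> p)"

definition rayleigh_tension :: "real \<Rightarrow> real \<Rightarrow> real \<Rightarrow> real" where
  "rayleigh_tension \<sigma> L0 L = \<sigma> * (L - L0)"

definition rayleigh_period :: "real \<Rightarrow> real \<Rightarrow> real \<Rightarrow> real \<Rightarrow> real" where
  "rayleigh_period m \<sigma> L0 L = 2 * pi / sqrt (2 * rayleigh_tension \<sigma> L0 L / (m * L))"

end

theory Submission
  imports Defs
begin

text \<open>
  Write \<open>k = 2 \<sigma> / m\<close>, \<open>S = sqrt (L\<^sup>2 + y\<^sup>2)\<close> and \<open>S0 = sqrt (L\<^sup>2 + y0\<^sup>2)\<close>. Conservation of energy reads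
  \<open>v\<^sup>2 = k (1 - 2 L0 / (S0 + S)) (y0\<^sup>2 - y\<^sup>2)\<close>, because \<open>S0 - S = (y0\<^sup>2 - y\<^sup>2) / (S0 + S)\<close>
  (\<open>wire_energy\<close>). Since \<open>L \<le> S \<le> S0\<close> along the motion, the factor in front of \<open>y0\<^sup>2 - y\<^sup>2\<close> lies
  between \<open>\<alpha>\<^sup>2 = k (1 - 2 L0 / (S0 + L))\<close> and \<open>\<beta>\<^sup>2 = k (1 - L0 / S0)\<close> (\<open>wire_speed_bounds\<close>).

  While \<open>v < 0\<close>, the phase \<open>arccos (y / y0)\<close> therefore grows at a rate between \<open>\<alpha>\<close> and \<open>\<beta>\<close>
  (\<open>phase_speed_bounds\<close>), so that the body travels from \<open>y0\<close> to \<open>- y0\<close> in a time \<open>\<tau>\<close> with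
  \<open>\<alpha> \<tau> \<le> pi \<le> \<beta> \<tau>\<close> (\<open>half_swing\<close>). Uniqueness of the solution (\<open>wire_motion_unique\<close>) gives
  \<open>y (t + \<tau>) = - y t\<close>; hence the least period is \<open>P = 2 \<tau>\<close>, and \<open>2 pi / \<beta> \<le> P \<le> 2 pi / \<alpha>\<close>
  (\<open>wire_period_bounds\<close>). This comparison with two harmonic oscillators replaces the evaluation
  of the elliptic period integral.

  Put \<open>\<lambda> = L0 / (L - L0)\<close>, \<open>Q = (y0 / (2 L))\<^sup>2\<close> and let \<open>\<rho>\<close> be the ratio of Rayleigh's period to \<open>P\<close>.
  The bounds on \<open>P\<close> become
  \<open>1 + \<lambda> (S0 - L) / (S0 + L) \<le> \<rho>\<^sup>2 \<le> 1 + \<lambda> (S0 - L) / S0\<close> (\<open>period_ratio_bounds\<close>), where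
  \<open>(S0 - L) / (S0 + L) > Q (1 - 2 Q)\<close> and \<open>(S0 - L) / S0 < 2 Q\<close> (\<open>elongation_bounds\<close>). As
  \<open>R = 1 - \<rho>\<close> and \<open>\<rho> > 1\<close>, the claim reduces to bounds for a square root near \<open>1\<close>; the constant
  \<open>1 / 32\<close> comes from \<open>Q (1 - 2 Q) \<le> 1 / 8\<close> (\<open>sqrt_perturbation_bounds\<close>).
\<close>

section \<open>Uniqueness of the motion\<close>

text \<open>
  Uniqueness for \<open>y'' = f y\<close> with \<open>f\<close> Lipschitz, forwards and backwards in time: the squared
  distance of two solutions in the phase plane satisfies a Gronwall inequality.
\<close>

lemma lipschitz_oscillator_unique:
  fixes f y1 y2 v1 v2 :: "real \<Rightarrow> real"
  assumes y1: "\<And>t. (y1 has_real_derivative v1 t) (at t)"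
    and v1: "\<And>t. (v1 has_real_derivative f (y1 t)) (at t)"
    and y2: "\<And>t. (y2 has_real_derivative v2 t) (at t)"
    and v2: "\<And>t. (v2 has_real_derivative f (y2 t)) (at t)"
    and lip: "\<And>x z. \<bar>f x - f z\<bar> \<le> K * \<bar>x - z\<bar>"
    and init: "y1 0 = y2 0" "v1 0 = v2 0"
  shows "y1 t = y2 t"
proof -
  define w where "w = (\<lambda>t. (y1 t - y2 t)\<^sup>2 + (v1 t - v2 t)\<^sup>2)"
  define w' where
    "w' = (\<lambda>t. 2 * (y1 t - y2 t) * (v1 t - v2 t) + 2 * (v1 t - v2 t) * (f (y1 t) - f (y2 t)))"
  have K: "K \<ge> 0" using lip[of 1 0] by simp
  have dw: "(w has_real_derivative w' t) (at t)" for t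
    unfolding w_def w'_def
    by (auto intro!: derivative_eq_intros y1 y2 v1 v2 simp: algebra_simps)
  have w0: "w 0 = 0" using init by (simp add: w_def)
  have w_nonneg: "w t \<ge> 0" for t by (simp add: w_def)
  have bound: "\<bar>w' t\<bar> \<le> (1 + K) * w t" for t
  proof -
    let ?p = "\<bar>y1 t - y2 t\<bar>" and ?q = "\<bar>v1 t - v2 t\<bar>"
    have "\<bar>w' t\<bar> \<le> 2 * ?p * ?q + 2 * ?q * \<bar>f (y1 t) - f (y2 t)\<bar>"
      unfolding w'_def by (rule order_trans[OF abs_triangle_ineq]) (simp only: abs_mult, simp)
    also have "\<dots> \<le> 2 * ?p * ?q + 2 * ?q * (K * ?p)"
      by (intro add_left_mono mult_left_mono lip) auto
    also have "\<dots> = (1 + K) * (2 * ?p * ?q)" by (simp add: algebra_simps)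
    also have "\<dots> \<le> (1 + K) * (?p\<^sup>2 + ?q\<^sup>2)"
      using K sum_squares_bound[of ?p ?q] by (intro mult_left_mono) auto
    finally show ?thesis by (simp add: w_def)
  qed
  \<comment> \<open>The bound on \<open>\<bar>w'\<bar>\<close> makes \<open>w\<close> times a decaying exponential monotone, away from \<open>t = 0\<close>
      in either direction of time.\<close>
  have "w t = 0"
  proof (cases "t \<ge> 0")
    case True
    have "w t * exp (- (1 + K) * t) \<le> w 0 * exp (- (1 + K) * 0)"
    proof (rule DERIV_nonpos_imp_nonincreasing[OF True])
      fix x
      have "((\<lambda>t. w t * exp (- (1 + K) * t)) has_real_derivative
          (w' x - (1 + K) * w x) * exp (- (1 + K) * x)) (at x)"
        by (auto intro!: derivative_eq_intros dw simp: algebra_simps)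
      moreover have "(w' x - (1 + K) * w x) * exp (- (1 + K) * x) \<le> 0"
        using bound[of x] by (intro mult_nonpos_nonneg) auto
      ultimately show "\<exists>z. ((\<lambda>t. w t * exp (- (1 + K) * t)) has_real_derivative z) (at x) \<and> z \<le> 0"
        by blast
    qed
    hence "w t \<le> 0" by (simp add: w0 mult_le_0_iff)
    with w_nonneg[of t] show ?thesis by simp
  next
    case False
    hence "t \<le> 0" by simp
    have "w t * exp ((1 + K) * t) \<le> w 0 * exp ((1 + K) * 0)"
    proof (rule DERIV_nonneg_imp_nondecreasing[OF \<open>t \<le> 0\<close>])
      fix x
      have "((\<lambda>t. w t * exp ((1 + K) * t)) has_real_derivative
          (w' x + (1 + K) * w x) * exp ((1 + K) * x)) (at x)"
        by (auto intro!: derivative_eq_intros dw simp: algebra_simps)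
      moreover have "(w' x + (1 + K) * w x) * exp ((1 + K) * x) \<ge> 0"
        using bound[of x] by (intro mult_nonneg_nonneg) auto
      ultimately show "\<exists>z. ((\<lambda>t. w t * exp ((1 + K) * t)) has_real_derivative z) (at x) \<and> z \<ge> 0"
        by blast
    qed
    hence "w t \<le> 0" by (simp add: w0 mult_le_0_iff)
    with w_nonneg[of t] show ?thesis by simp
  qed
  thus ?thesis by (simp add: w_def sum_power2_eq_zero_iff)
qed

text \<open>
  The Lipschitz constant \<open>k\<close> comes from the derivative \<open>- k (1 - L0 L\<^sup>2 / S\<^sup>3)\<close> of the force, in which
  \<open>0 \<le> L0 L\<^sup>2 \<le> S\<^sup>3\<close>.
\<close>

lemma wire_force_lipschitz:
  fixes k L0 L :: real
  assumes "k \<ge> 0" "0 \<le> L0" "L0 \<le> L" "0 < L"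
  shows "\<bar>- (k * ((sqrt (L\<^sup>2 + x\<^sup>2) - L0) / sqrt (L\<^sup>2 + x\<^sup>2))) * x
          - - (k * ((sqrt (L\<^sup>2 + z\<^sup>2) - L0) / sqrt (L\<^sup>2 + z\<^sup>2))) * z\<bar> \<le> k * \<bar>x - z\<bar>"
proof -
  define S where "S = (\<lambda>u. sqrt (L\<^sup>2 + u\<^sup>2))"
  define F where "F = (\<lambda>u. - (k * ((S u - L0) / S u)) * u)"
  have pos: "L\<^sup>2 + u\<^sup>2 > 0" for u using assms by (simp add: add_pos_nonneg)
  have SL: "S u \<ge> L" for u unfolding S_def by (rule real_le_rsqrt) simp
  have S_pos: "S u > 0" for u using SL[of u] assms by linarith
  have S_sq: "S u * S u = L\<^sup>2 + u\<^sup>2" for u unfolding S_def using pos[of u] by simp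
  have dS: "(S has_real_derivative u / S u) (at u)" for u
    unfolding S_def using pos[of u]
    by (auto intro!: derivative_eq_intros simp: field_simps)
  have dF: "(F has_real_derivative - k * (1 - L0 * L\<^sup>2 / (S u)^3)) (at u)" for u
  proof -
    have "F = (\<lambda>u. k * (L0 * u / S u - u))"
    proof
      fix u show "F u = k * (L0 * u / S u - u)"
        using S_pos[of u] by (simp add: F_def field_simps)
    qed
    moreover have "((\<lambda>u. k * (L0 * u / S u - u)) has_real_derivative
        k * ((L0 * S u - L0 * u * (u / S u)) / (S u * S u) - 1)) (at u)"
      using S_pos[of u] by (auto intro!: derivative_eq_intros dS)
    moreover have "k * ((L0 * S u - L0 * u * (u / S u)) / (S u * S u) - 1)
        = - k * (1 - L0 * L\<^sup>2 / (S u)^3)"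
    proof -
      have "L0 * S u - L0 * u * (u / S u) = L0 * (S u * S u - u\<^sup>2) / S u"
        using S_pos[of u] by (simp add: field_simps power2_eq_square)
      also have "\<dots> = L0 * L\<^sup>2 / S u" by (simp add: S_sq)
      finally show ?thesis by (simp add: power3_eq_cube algebra_simps)
    qed
    ultimately show ?thesis by simp
  qed
  have "norm (- k * (1 - L0 * L\<^sup>2 / (S u)^3)) \<le> k" for u
  proof -
    have "L0 * L\<^sup>2 \<le> L * L\<^sup>2" using assms by (intro mult_right_mono) auto
    also have "\<dots> = L ^ 3" by (simp add: power3_eq_cube power2_eq_square)
    also have "\<dots> \<le> S u ^ 3" using SL[of u] assms by (intro power_mono) auto
    finally have "L0 * L\<^sup>2 / (S u)^3 \<le> 1" using S_pos[of u] by (simp add: field_simps)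
    moreover have "L0 * L\<^sup>2 / (S u)^3 \<ge> 0" using S_pos[of u] assms by simp
    ultimately have "\<bar>1 - L0 * L\<^sup>2 / (S u)^3\<bar> \<le> 1" by linarith
    thus ?thesis using assms(1) by (simp add: abs_mult mult_left_le)
  qed
  hence "norm (F x - F z) \<le> k * norm (x - z)"
    using dF by (intro field_differentiable_bound[where S = UNIV]) (auto intro: has_field_derivative_at_within)
  thus ?thesis by (simp add: F_def S_def)
qed

lemma wire_motion_unique:
  assumes "m > 0" "\<sigma> > 0" "0 < L0" "L0 < L"
    and "wire_motion m \<sigma> L0 L y0 y" "wire_motion m \<sigma> L0 L y0 z"
  shows "y t = z t"
proof -
  define f where "f = (\<lambda>x. - (2 * \<sigma> / m * ((sqrt (L\<^sup>2 + x\<^sup>2) - L0) / sqrt (L\<^sup>2 + x\<^sup>2))) * x)"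
  obtain v a where yv: "\<And>t. (y has_real_derivative v t) (at t)"
      "\<And>t. (v has_real_derivative a t) (at t)" "y 0 = y0" "v 0 = 0"
    and a: "\<And>t. a t + (2 * \<sigma> / m * ((sqrt (L\<^sup>2 + (y t)\<^sup>2) - L0) / sqrt (L\<^sup>2 + (y t)\<^sup>2))) * y t = 0"
    using assms(5) unfolding wire_motion_def by blast
  obtain w b where zw: "\<And>t. (z has_real_derivative w t) (at t)"
      "\<And>t. (w has_real_derivative b t) (at t)" "z 0 = y0" "w 0 = 0"
    and b: "\<And>t. b t + (2 * \<sigma> / m * ((sqrt (L\<^sup>2 + (z t)\<^sup>2) - L0) / sqrt (L\<^sup>2 + (z t)\<^sup>2))) * z t = 0"
    using assms(6) unfolding wire_motion_def by blast
  have "a t = f (y t)" "b t = f (z t)" for t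
    using a[of t] b[of t] by (simp_all add: f_def)
  moreover have "\<bar>f x - f u\<bar> \<le> (2 * \<sigma> / m) * \<bar>x - u\<bar>" for x u
    unfolding f_def using assms by (intro wire_force_lipschitz) auto
  ultimately show ?thesis
    using yv zw lipschitz_oscillator_unique[of y v f z w "2 * \<sigma> / m" t] by simp
qed

section \<open>Comparison with harmonic oscillators\<close>

text \<open>
  The phase \<open>arccos (y / A)\<close> has derivative \<open>- v / sqrt (A\<^sup>2 - y\<^sup>2)\<close> on the open interval only, since
  \<open>arccos\<close> is singular at the turning points; its continuity on the closed interval suffices for the
  mean value theorem.
\<close>

lemma phase_speed_bounds:
  fixes y v :: "real \<Rightarrow> real"
  assumes dy: "\<And>t. (y has_real_derivative v t) (at t)"
    and y0: "y 0 = A" and A: "A > 0" and T: "T > 0"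
    and v_neg: "\<And>t. 0 < t \<Longrightarrow> t < T \<Longrightarrow> v t < 0"
    and a: "a > 0" and b: "b > 0"
    and low: "\<And>t. a\<^sup>2 * (A\<^sup>2 - (y t)\<^sup>2) \<le> (v t)\<^sup>2"
    and high: "\<And>t. (v t)\<^sup>2 \<le> b\<^sup>2 * (A\<^sup>2 - (y t)\<^sup>2)"
  shows "a * T \<le> arccos (y T / A)" and "arccos (y T / A) \<le> b * T"
proof -
  let ?\<phi> = "\<lambda>t. arccos (y t / A)"
  have cont_y: "continuous_on S y" for S
    using dy by (blast intro: continuous_at_imp_continuous_on DERIV_isCont)
  have amp: "\<bar>y t\<bar> \<le> A" for t
  proof -
    have "0 \<le> b\<^sup>2 * (A\<^sup>2 - (y t)\<^sup>2)" using high[of t] zero_le_power2[of "v t"] by linarith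
    hence "(y t)\<^sup>2 \<le> A\<^sup>2" using b by (simp add: zero_le_mult_iff)
    thus ?thesis using A by (simp add: abs_le_square_iff[symmetric])
  qed
  have cont: "continuous_on {0..T} ?\<phi>"
  proof (intro continuous_on_arccos continuous_on_divide continuous_on_const cont_y ballI)
    fix t
    show "- 1 \<le> y t / A \<and> y t / A \<le> 1"
      using amp[of t] A by (auto simp: field_simps)
  qed (use A in auto)
  have d\<phi>: "(?\<phi> has_real_derivative - v t / sqrt (A\<^sup>2 - (y t)\<^sup>2)) (at t)"
    and s_pos: "A\<^sup>2 - (y t)\<^sup>2 > 0" if t: "0 < t" "t < T" for t
  proof -
    have "0 < (v t)\<^sup>2" using v_neg[OF t] by simp
    hence "0 < b\<^sup>2 * (A\<^sup>2 - (y t)\<^sup>2)" using high[of t] by linarith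
    thus s: "A\<^sup>2 - (y t)\<^sup>2 > 0" using b by (simp add: zero_less_mult_iff)
    have lt: "\<bar>y t\<bar> < A"
      using s A abs_le_square_iff[of A "y t"] by auto
    have "((\<lambda>t. y t / A) has_real_derivative v t / A) (at t)"
      using A by (auto intro!: derivative_eq_intros dy)
    moreover have "(arccos has_real_derivative inverse (- sqrt (1 - (y t / A)\<^sup>2))) (at (y t / A))"
      using lt A by (intro DERIV_arccos) (auto simp: field_simps)
    ultimately have "(?\<phi> has_real_derivative inverse (- sqrt (1 - (y t / A)\<^sup>2)) * (v t / A)) (at t)"
      using DERIV_chain2[of arccos _ "\<lambda>t. y t / A"] by blast
    moreover have "sqrt (A\<^sup>2 - (y t)\<^sup>2) = A * sqrt (1 - (y t / A)\<^sup>2)"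
    proof -
      have "A\<^sup>2 - (y t)\<^sup>2 = A\<^sup>2 * (1 - (y t / A)\<^sup>2)" using A by (simp add: field_simps)
      thus ?thesis using A by (simp add: real_sqrt_mult)
    qed
    ultimately show "(?\<phi> has_real_derivative - v t / sqrt (A\<^sup>2 - (y t)\<^sup>2)) (at t)"
      by (simp add: divide_simps mult.commute)
  qed
  have "?\<phi> differentiable (at t)" if "0 < t" "t < T" for t
    using d\<phi>[OF that] real_differentiable_def by blast
  then obtain l t where t: "0 < t" "t < T"
    and l: "(?\<phi> has_real_derivative l) (at t)" "?\<phi> T - ?\<phi> 0 = (T - 0) * l"
    using MVT[OF T cont] by blast
  have mvt: "?\<phi> T - ?\<phi> 0 = (T - 0) * (- v t / sqrt (A\<^sup>2 - (y t)\<^sup>2))"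
    using l DERIV_unique[OF l(1) d\<phi>[OF t]] by simp
  let ?s = "sqrt (A\<^sup>2 - (y t)\<^sup>2)"
  have s: "?s > 0" "?s\<^sup>2 = A\<^sup>2 - (y t)\<^sup>2" using s_pos[OF t] by auto
  have "(a * ?s)\<^sup>2 \<le> (- v t)\<^sup>2" "(- v t)\<^sup>2 \<le> (b * ?s)\<^sup>2"
    using low[of t] high[of t] s by (simp_all add: power_mult_distrib)
  hence "a * ?s \<le> - v t" "- v t \<le> b * ?s"
    using v_neg[OF t] s b by (auto intro: power2_le_imp_le)
  hence "a \<le> - v t / ?s" "- v t / ?s \<le> b" using s by (simp_all add: field_simps)
  moreover have "?\<phi> T = T * (- v t / ?s)" using mvt y0 A by simp
  ultimately show "a * T \<le> arccos (y T / A)" "arccos (y T / A) \<le> b * T"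
    using T by (simp_all only: mult.commute[of a] mult.commute[of b] mult_le_cancel_left_pos)
qed

text \<open>The time \<open>\<tau>\<close> is the first positive zero of the velocity, at which the body has reached \<open>- A\<close>.\<close>

lemma half_swing:
  fixes y v acc :: "real \<Rightarrow> real"
  assumes dy: "\<And>t. (y has_real_derivative v t) (at t)"
    and dv: "\<And>t. (v has_real_derivative acc t) (at t)"
    and y0: "y 0 = A" and v0: "v 0 = 0" and acc0: "acc 0 < 0" and A: "A > 0"
    and a: "a > 0" and b: "b > 0"
    and low: "\<And>t. a\<^sup>2 * (A\<^sup>2 - (y t)\<^sup>2) \<le> (v t)\<^sup>2"
    and high: "\<And>t. (v t)\<^sup>2 \<le> b\<^sup>2 * (A\<^sup>2 - (y t)\<^sup>2)"
  obtains \<tau> where "\<tau> > 0" "v \<tau> = 0" "y \<tau> = - A" "a * \<tau> \<le> pi" "pi \<le> b * \<tau>"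
    "\<And>t. 0 < t \<Longrightarrow> t < \<tau> \<Longrightarrow> \<bar>y t\<bar> < A"
proof -
  have cont_v: "continuous_on S v" for S
    using dv by (blast intro: continuous_at_imp_continuous_on DERIV_isCont)
  obtain d where d: "d > 0" "\<And>h. h > 0 \<Longrightarrow> h < d \<Longrightarrow> v h < 0"
    using DERIV_neg_dec_right[OF dv acc0] v0 by auto
  define t1 where "t1 = d / 2"
  have t1: "t1 > 0" "v t1 < 0" "\<And>h. h > 0 \<Longrightarrow> h \<le> t1 \<Longrightarrow> v h < 0"
    using d by (auto simp: t1_def)
  let ?Z = "{t \<in> {t1..}. v t = 0}"
  have "\<exists>t\<ge>t1. v t \<ge> 0"
  proof (rule ccontr)
    assume "\<not> ?thesis"
    \<comment> \<open>If the velocity never vanished again, the phase would exceed \<open>pi\<close> at time \<open>4 / a\<close>.\<close>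
    hence neg: "v t < 0" if "t > 0" for t
      using t1(3)[OF that] by (meson linorder_not_le not_le_imp_less order.strict_implies_order)
    let ?T = "4 / a"
    have "a * ?T \<le> arccos (y ?T / A)"
      using a neg by (intro phase_speed_bounds(1)[OF dy y0 A _ _ a b low high]) auto
    moreover have "arccos (y ?T / A) \<le> pi"
    proof (rule arccos_ubound)
      have "0 \<le> b\<^sup>2 * (A\<^sup>2 - (y ?T)\<^sup>2)" using high[of ?T] zero_le_power2[of "v ?T"] by linarith
      hence "(y ?T)\<^sup>2 \<le> A\<^sup>2" using b by (simp add: zero_le_mult_iff)
      hence "\<bar>y ?T\<bar> \<le> A" using A by (simp add: abs_le_square_iff[symmetric])
      thus "- 1 \<le> y ?T / A" "y ?T / A \<le> 1" using A by (auto simp: field_simps)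
    qed
    ultimately show False using a pi_less_4 by simp
  qed
  then obtain t2 where t2: "t2 \<ge> t1" "v t2 \<ge> 0" by blast
  obtain t3 where "t3 \<ge> t1" "v t3 = 0"
    using IVT'[of v t1 0 t2] t1 t2 cont_v by force
  hence ne: "?Z \<noteq> {}" by auto
  have bdd: "bdd_below ?Z" by (auto intro: bdd_belowI[of _ t1])
  have "closed ?Z" by (intro continuous_closed_preimage_constant cont_v) auto
  define \<tau> where "\<tau> = Inf ?Z"
  have "\<tau> \<in> ?Z" unfolding \<tau>_def using \<open>closed ?Z\<close> ne bdd by (rule closed_contains_Inf[rotated 2])
  hence \<tau>: "\<tau> \<ge> t1" "v \<tau> = 0" by auto
  hence \<tau>_pos: "\<tau> > 0" using t1 by simp
  have neg: "v t < 0" if "0 < t" "t < \<tau>" for t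
  proof (rule ccontr)
    assume nn: "\<not> v t < 0"
    hence "t > t1" using t1(3)[OF that(1)] by force
    then obtain u where "t1 \<le> u" "u \<le> t" "v u = 0"
      using IVT'[of v t1 0 t] t1 nn cont_v by force
    hence "\<tau> \<le> u" unfolding \<tau>_def using bdd by (intro cInf_lower) auto
    thus False using \<open>u \<le> t\<close> that by simp
  qed
  have amp: "\<bar>y t\<bar> < A" if "0 < t" "t < \<tau>" for t
  proof -
    have "0 < (v t)\<^sup>2" using neg[OF that] by simp
    hence "0 < b\<^sup>2 * (A\<^sup>2 - (y t)\<^sup>2)" using high[of t] by linarith
    hence "(y t)\<^sup>2 < A\<^sup>2" using b by (simp add: zero_less_mult_iff)
    thus ?thesis using A abs_le_square_iff[of A "y t"] by auto
  qed
  have "a\<^sup>2 * (A\<^sup>2 - (y \<tau>)\<^sup>2) \<le> 0" "0 \<le> b\<^sup>2 * (A\<^sup>2 - (y \<tau>)\<^sup>2)"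
    using low[of \<tau>] high[of \<tau>] \<tau>(2) by simp_all
  hence "(y \<tau>)\<^sup>2 = A\<^sup>2" using a b by (simp add: zero_le_mult_iff mult_le_0_iff)
  moreover have "y \<tau> < y 0"
    by (rule DERIV_neg_imp_decreasing_open[OF \<tau>_pos]) 
      (use dy neg in \<open>auto intro: DERIV_continuous_on has_field_derivative_at_within\<close>)
  ultimately have y\<tau>: "y \<tau> = - A" using y0 by (auto simp: power2_eq_iff)
  have "arccos (y \<tau> / A) = pi" using y\<tau> A by simp
  with phase_speed_bounds[OF dy y0 A \<tau>_pos neg a b low high]
  have "a * \<tau> \<le> pi" "pi \<le> b * \<tau>" by simp_all
  with that \<tau>_pos \<tau>(2) y\<tau> amp show thesis by blast
qed

section \<open>Energy and the least period of the wire\<close>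

lemma wire_energy:
  assumes "m > 0" "\<sigma> > 0" "0 < L0" "L0 < L"
    and dy: "\<And>t. (y has_real_derivative v t) (at t)"
    and dv: "\<And>t. (v has_real_derivative a t) (at t)"
    and ode: "\<And>t. a t + (2 * \<sigma> / m * ((sqrt (L\<^sup>2 + (y t)\<^sup>2) - L0) / sqrt (L\<^sup>2 + (y t)\<^sup>2))) * y t = 0"
    and "y 0 = y0" "v 0 = 0"
  shows "(v t)\<^sup>2 = 2 * \<sigma> / m * (1 - 2 * L0 / (sqrt (L\<^sup>2 + y0\<^sup>2) + sqrt (L\<^sup>2 + (y t)\<^sup>2)))
      * (y0\<^sup>2 - (y t)\<^sup>2)"
proof -
  define k where "k = 2 * \<sigma> / m"
  define S where "S = (\<lambda>u. sqrt (L\<^sup>2 + u\<^sup>2))"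
  define E where "E = (\<lambda>t. (v t)\<^sup>2 + k * ((y t)\<^sup>2 - 2 * L0 * S (y t)))"
  have pos: "L\<^sup>2 + u\<^sup>2 > 0" for u using assms by (simp add: add_pos_nonneg)
  have S_pos: "S u > 0" for u using pos[of u] by (simp add: S_def)
  have S_sq: "(S u)\<^sup>2 = L\<^sup>2 + u\<^sup>2" for u unfolding S_def using pos[of u] by simp
  have dS: "(S has_real_derivative u / S u) (at u)" for u
    unfolding S_def using pos[of u]
    by (auto intro!: derivative_eq_intros simp: field_simps)
  have "(E has_real_derivative 0) (at t)" for t
  proof -
    have "((\<lambda>t. S (y t)) has_real_derivative y t / S (y t) * v t) (at t)"
      using DERIV_chain2[OF dS dy] .
    hence "(E has_real_derivative 2 * v t * a t + k * (2 * y t * v t - 2 * L0 * (y t / S (y t) * v t))) (at t)"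
      unfolding E_def by (auto intro!: derivative_eq_intros dy dv)
    moreover have "a t = - (k * ((S (y t) - L0) / S (y t))) * y t"
      using ode[of t] by (simp add: S_def k_def)
    hence "a t = - k * (y t - L0 * (y t / S (y t)))"
      using S_pos[of "y t"] by (simp add: field_simps)
    hence "2 * v t * a t + k * (2 * y t * v t - 2 * L0 * (y t / S (y t) * v t)) = 0"
      by (simp only:) (simp add: algebra_simps)
    ultimately show ?thesis by simp
  qed
  hence "E t = E 0" using DERIV_isconst_all by blast
  hence 1: "(v t)\<^sup>2 = k * ((y0\<^sup>2 - (y t)\<^sup>2) - 2 * L0 * (S y0 - S (y t)))"
    using assms by (simp add: E_def algebra_simps)
  \<comment> \<open>Rationalising the difference of roots exhibits the factor \<open>y0\<^sup>2 - y\<^sup>2\<close> in the potential energy.\<close>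
  have "(S y0 - S (y t)) * (S y0 + S (y t)) = y0\<^sup>2 - (y t)\<^sup>2"
    using S_sq[of y0] S_sq[of "y t"] by (simp add: algebra_simps power2_eq_square)
  hence "S y0 - S (y t) = (y0\<^sup>2 - (y t)\<^sup>2) / (S y0 + S (y t))"
    using S_pos[of y0] S_pos[of "y t"] by (simp add: eq_divide_eq)
  with 1 have "(v t)\<^sup>2 = k * ((y0\<^sup>2 - (y t)\<^sup>2) - 2 * L0 * ((y0\<^sup>2 - (y t)\<^sup>2) / (S y0 + S (y t))))"
    by simp
  also have "\<dots> = k * (1 - 2 * L0 / (S y0 + S (y t))) * (y0\<^sup>2 - (y t)\<^sup>2)"
    by (simp add: algebra_simps)
  finally show ?thesis by (simp add: k_def S_def)
qed

text \<open>
  The two constants are the values of \<open>k (1 - 2 L0 / (S0 + S))\<close> at the centre, where \<open>S = L\<close>, and at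
  the turning points, where \<open>S = S0\<close>.
\<close>

lemma wire_speed_bounds:
  assumes "m > 0" "\<sigma> > 0" "0 < L0" "L0 < L" "y0 > 0"
    and dy: "\<And>t. (y has_real_derivative v t) (at t)"
    and dv: "\<And>t. (v has_real_derivative a t) (at t)"
    and ode: "\<And>t. a t + (2 * \<sigma> / m * ((sqrt (L\<^sup>2 + (y t)\<^sup>2) - L0) / sqrt (L\<^sup>2 + (y t)\<^sup>2))) * y t = 0"
    and init: "y 0 = y0" "v 0 = 0"
  shows "2 * \<sigma> / m * (1 - 2 * L0 / (sqrt (L\<^sup>2 + y0\<^sup>2) + L)) * (y0\<^sup>2 - (y t)\<^sup>2) \<le> (v t)\<^sup>2"
    and "(v t)\<^sup>2 \<le> 2 * \<sigma> / m * (1 - L0 / sqrt (L\<^sup>2 + y0\<^sup>2)) * (y0\<^sup>2 - (y t)\<^sup>2)"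
proof -
  define k where "k = 2 * \<sigma> / m"
  define M where "M = sqrt (L\<^sup>2 + y0\<^sup>2)"
  define S where "S = sqrt (L\<^sup>2 + (y t)\<^sup>2)"
  have k: "k > 0" using assms by (simp add: k_def)
  have S_ge: "S \<ge> L" and M_ge: "M \<ge> L" unfolding S_def M_def by (rule real_le_rsqrt, simp)+
  have eq: "(v t)\<^sup>2 = k * (1 - 2 * L0 / (M + S)) * (y0\<^sup>2 - (y t)\<^sup>2)"
    unfolding k_def M_def S_def by (rule wire_energy[OF assms(1-4) dy dv ode init])
  have "2 * L0 < M + S" using S_ge M_ge assms by linarith
  hence "1 - 2 * L0 / (M + S) > 0" using assms by (simp add: field_simps)
  hence "k * (1 - 2 * L0 / (M + S)) > 0" using k by simp
  moreover have "0 \<le> k * (1 - 2 * L0 / (M + S)) * (y0\<^sup>2 - (y t)\<^sup>2)"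
    using eq by (metis zero_le_power2)
  ultimately have nn: "y0\<^sup>2 - (y t)\<^sup>2 \<ge> 0" by (metis zero_le_mult_iff not_le)
  hence "S \<le> M" by (simp add: S_def M_def)
  have "2 * L0 / (M + S) \<le> 2 * L0 / (M + L)"
    using S_ge M_ge assms by (intro divide_left_mono mult_pos_pos) auto
  thus "2 * \<sigma> / m * (1 - 2 * L0 / (sqrt (L\<^sup>2 + y0\<^sup>2) + L)) * (y0\<^sup>2 - (y t)\<^sup>2) \<le> (v t)\<^sup>2"
    unfolding eq M_def[symmetric] k_def[symmetric] using k nn by (intro mult_right_mono mult_left_mono) auto
  have "2 * L0 / (M + M) \<le> 2 * L0 / (M + S)"
    using S_ge M_ge \<open>S \<le> M\<close> assms by (intro divide_left_mono mult_pos_pos) auto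
  hence "L0 / M \<le> 2 * L0 / (M + S)" by (simp add: mult_2[symmetric])
  thus "(v t)\<^sup>2 \<le> 2 * \<sigma> / m * (1 - L0 / sqrt (L\<^sup>2 + y0\<^sup>2)) * (y0\<^sup>2 - (y t)\<^sup>2)"
    unfolding eq M_def[symmetric] k_def[symmetric] using k nn by (intro mult_right_mono mult_left_mono) auto
qed

lemma wire_period_bounds:
  assumes pos: "m > 0" "\<sigma> > 0" "0 < L0" "L0 < L" "y0 > 0"
    and motion: "wire_motion m \<sigma> L0 L y0 y"
    and period: "is_least_period P y"
  shows "P > 0"
    and "sqrt (2 * \<sigma> / m * (1 - 2 * L0 / (sqrt (L\<^sup>2 + y0\<^sup>2) + L))) * P \<le> 2 * pi"
    and "2 * pi \<le> sqrt (2 * \<sigma> / m * (1 - L0 / sqrt (L\<^sup>2 + y0\<^sup>2))) * P"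
proof -
  let ?M = "sqrt (L\<^sup>2 + y0\<^sup>2)"
  let ?A = "2 * \<sigma> / m * (1 - 2 * L0 / (?M + L))" and ?B = "2 * \<sigma> / m * (1 - L0 / ?M)"
  obtain v a where dy: "\<And>t. (y has_real_derivative v t) (at t)"
    and dv: "\<And>t. (v has_real_derivative a t) (at t)" and init: "y 0 = y0" "v 0 = 0"
    and ode: "\<And>t. a t + (2 * \<sigma> / m * ((sqrt (L\<^sup>2 + (y t)\<^sup>2) - L0) / sqrt (L\<^sup>2 + (y t)\<^sup>2))) * y t = 0"
    using motion unfolding wire_motion_def by blast
  have M_ge: "?M \<ge> L" by (rule real_le_rsqrt) simp
  have "2 * L0 < ?M + L" "L0 < ?M" "0 < ?M" using pos M_ge by linarith+
  hence "2 * L0 / (?M + L) < 1" "L0 / ?M < 1"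
    using pos by (subst divide_less_eq_1_pos; linarith)+
  hence A: "?A > 0" and B: "?B > 0" using pos by simp_all
  have low: "(sqrt ?A)\<^sup>2 * (y0\<^sup>2 - (y t)\<^sup>2) \<le> (v t)\<^sup>2" for t
    using wire_speed_bounds(1)[OF pos dy dv ode init, of t] A by simp
  have high: "(v t)\<^sup>2 \<le> (sqrt ?B)\<^sup>2 * (y0\<^sup>2 - (y t)\<^sup>2)" for t
    using wire_speed_bounds(2)[OF pos dy dv ode init, of t] B by simp
  have "2 * \<sigma> / m * ((?M - L0) / ?M) * y0 > 0"
    using pos \<open>L0 < ?M\<close> \<open>0 < ?M\<close> by (intro mult_pos_pos divide_pos_pos) simp_all
  hence a0: "a 0 < 0" using ode[of 0] init by simp
  obtain \<tau> where \<tau>: "\<tau> > 0" "v \<tau> = 0" "y \<tau> = - y0" "sqrt ?A * \<tau> \<le> pi" "pi \<le> sqrt ?B * \<tau>"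
    and amp: "\<And>t. 0 < t \<Longrightarrow> t < \<tau> \<Longrightarrow> \<bar>y t\<bar> < y0"
    using half_swing[OF dy dv init a0 pos(5) _ _ low high] A B by (metis real_sqrt_gt_0_iff)
  \<comment> \<open>The force is odd, so the reflected motion restarted at time \<open>\<tau>\<close> solves the same initial value
      problem.\<close>
  have "wire_motion m \<sigma> L0 L y0 (\<lambda>t. - y (t + \<tau>))"
    unfolding wire_motion_def
  proof (rule exI[of _ "\<lambda>t. - v (t + \<tau>)"], rule exI[of _ "\<lambda>t. - a (t + \<tau>)"], intro conjI allI)
    fix t
    show "((\<lambda>t. - y (t + \<tau>)) has_real_derivative - v (t + \<tau>)) (at t)"
      using dy[of "t + \<tau>"] by (intro DERIV_minus) (simp add: DERIV_shift)
    show "((\<lambda>t. - v (t + \<tau>)) has_real_derivative - a (t + \<tau>)) (at t)"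
      using dv[of "t + \<tau>"] by (intro DERIV_minus) (simp add: DERIV_shift)
    show "- a (t + \<tau>) + 2 * \<sigma> / m * ((sqrt (L\<^sup>2 + (- y (t + \<tau>))\<^sup>2) - L0)
        / sqrt (L\<^sup>2 + (- y (t + \<tau>))\<^sup>2)) * - y (t + \<tau>) = 0"
      using ode[of "t + \<tau>"] by simp
  qed (use \<tau> in simp_all)
  hence anti: "y (t + \<tau>) = - y t" for t
    using wire_motion_unique[OF pos(1-4) motion, of "\<lambda>t. - y (t + \<tau>)" t] by simp
  have "y (t + 2 * \<tau>) = y t" for t
    using anti[of "t + \<tau>"] anti[of t] by (simp add: algebra_simps)
  hence "is_period (2 * \<tau>) y" using \<tau> by (simp add: is_period_def)
  hence le: "P \<le> 2 * \<tau>" using period by (simp add: is_least_period_def)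
  show P: "P > 0" using period by (simp add: is_least_period_def is_period_def)
  have yP: "y P = y0"
    using period init by (metis add_0 is_least_period_def is_period_def)
  \<comment> \<open>Strictly between \<open>0\<close> and \<open>2 * \<tau>\<close> the displacement stays below \<open>y0\<close>, so no shorter period exists.\<close>
  have "P \<ge> 2 * \<tau>"
  proof (rule ccontr)
    assume "\<not> ?thesis"
    then consider "P < \<tau>" | "P = \<tau>" | "\<tau> < P" "P < 2 * \<tau>" by linarith
    thus False
    proof cases
      case 1 thus False using amp[OF P] yP by simp
    next
      case 2 thus False using \<tau> yP pos by simp
    next
      case 3 thus False using amp[of "P - \<tau>"] anti[of "P - \<tau>"] yP by simp
    qed
  qed
  with le have "P = 2 * \<tau>" by simp
  thus "sqrt ?A * P \<le> 2 * pi" "2 * pi \<le> sqrt ?B * P" using \<tau> by simp_all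
qed

section \<open>The ratio of Rayleigh's period to the true period\<close>

lemma period_ratio_bounds:
  assumes pos: "m > 0" "\<sigma> > 0" "0 < L0" "L0 < L" "y0 > 0"
    and motion: "wire_motion m \<sigma> L0 L y0 y"
    and period: "is_least_period P y"
  defines "\<rho> \<equiv> rayleigh_period m \<sigma> L0 L / P"
    and "S0 \<equiv> sqrt (L\<^sup>2 + y0\<^sup>2)"
  shows "\<rho> > 0"
    and "1 + L0 / (L - L0) * ((S0 - L) / (S0 + L)) \<le> \<rho>\<^sup>2"
    and "\<rho>\<^sup>2 \<le> 1 + L0 / (L - L0) * ((S0 - L) / S0)"
proof -
  define k where "k = 2 * \<sigma> / m"
  define w where "w = k * (1 - L0 / L)"
  have k: "k > 0" using pos by (simp add: k_def)
  have S0: "S0 \<ge> L" unfolding S0_def by (rule real_le_rsqrt) simp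
  have L: "L > 0" using pos by simp
  have w: "w > 0" using k pos by (auto simp: w_def)
  note b = wire_period_bounds[OF pos motion period, folded S0_def k_def]
  have "2 * rayleigh_tension \<sigma> L0 L / (m * L) = w"
    using pos by (simp add: rayleigh_tension_def w_def k_def field_simps)
  hence \<rho>: "\<rho> = 2 * pi / (sqrt w * P)" by (simp add: \<rho>_def rayleigh_period_def)
  show "\<rho> > 0" using w b(1) by (simp add: \<rho>)
  have r2: "\<rho>\<^sup>2 = (2 * pi)\<^sup>2 / (w * P\<^sup>2)" using w by (simp add: \<rho> power_divide power_mult_distrib)
  have A: "k * (1 - 2 * L0 / (S0 + L)) > 0" and B: "k * (1 - L0 / S0) > 0"
    using pos S0 k by simp_all
  have "(sqrt (k * (1 - 2 * L0 / (S0 + L))) * P)\<^sup>2 \<le> (2 * pi)\<^sup>2"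
    using A b by (intro power_mono) auto
  hence "k * (1 - 2 * L0 / (S0 + L)) * P\<^sup>2 \<le> (2 * pi)\<^sup>2"
    using A by (simp add: power_mult_distrib)
  hence "k * (1 - 2 * L0 / (S0 + L)) / w \<le> \<rho>\<^sup>2"
    unfolding r2 using w b(1) by (simp add: pos_divide_le_eq pos_le_divide_eq)
  moreover have "k * (1 - 2 * L0 / (S0 + L)) / w = 1 + L0 / (L - L0) * ((S0 - L) / (S0 + L))"
  proof -
    have "S0 + L > 0" using S0 L by simp
    thus ?thesis unfolding w_def using k L pos by (simp add: divide_simps) (simp add: algebra_simps)
  qed
  ultimately show "1 + L0 / (L - L0) * ((S0 - L) / (S0 + L)) \<le> \<rho>\<^sup>2" by simp
  have "(2 * pi)\<^sup>2 \<le> (sqrt (k * (1 - L0 / S0)) * P)\<^sup>2"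
    using b by (intro power_mono) auto
  hence "(2 * pi)\<^sup>2 \<le> k * (1 - L0 / S0) * P\<^sup>2"
    using B by (simp add: power_mult_distrib)
  hence "\<rho>\<^sup>2 \<le> k * (1 - L0 / S0) / w"
    unfolding r2 using w b(1) by (simp add: pos_divide_le_eq pos_le_divide_eq)
  moreover have "k * (1 - L0 / S0) / w = 1 + L0 / (L - L0) * ((S0 - L) / S0)"
  proof -
    have "S0 > 0" using S0 L by simp
    thus ?thesis unfolding w_def using k L pos by (simp add: divide_simps) (simp add: algebra_simps)
  qed
  ultimately show "\<rho>\<^sup>2 \<le> 1 + L0 / (L - L0) * ((S0 - L) / S0)" by simp
qed

text \<open>
  Bounds for the two quantities in the preceding lemma, both obtained from
  \<open>S0 - L = y0\<^sup>2 / (S0 + L)\<close> and \<open>L < S0 \<le> L (1 + 2 Q)\<close>.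
\<close>

lemma elongation_bounds:
  fixes L y0 :: real
  assumes "L > 0" "y0 > 0"
  defines "S0 \<equiv> sqrt (L\<^sup>2 + y0\<^sup>2)" and "Q \<equiv> (y0 / (2 * L))\<^sup>2"
  shows "S0 > L" and "(S0 - L) / S0 < 2 * Q" and "Q * (1 - 2 * Q) < (S0 - L) / (S0 + L)"
proof -
  have Q: "y0\<^sup>2 = 4 * Q * L\<^sup>2" and Q_pos: "Q > 0" using assms by (auto simp: Q_def power_divide field_simps)
  have sq: "S0\<^sup>2 = L\<^sup>2 + y0\<^sup>2" by (simp add: S0_def)
  show gt: "S0 > L" unfolding S0_def using assms by (intro real_less_rsqrt) simp
  have diff: "S0 - L = 4 * Q * L\<^sup>2 / (S0 + L)"
    using sq Q gt assms by (simp add: field_simps power2_eq_square)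
  have "L\<^sup>2 * 2 < S0 * (S0 + L)"
    unfolding power2_eq_square distrib_left
    using mult_strict_mono[OF gt gt] mult_strict_right_mono[OF gt assms(1)] gt assms(1) by linarith
  hence "2 * Q * (L\<^sup>2 * 2) < 2 * Q * (S0 * (S0 + L))" using Q_pos by simp
  moreover have "S0 * (S0 + L) > 0" using gt assms(1) by simp
  ultimately have "2 * Q * (L\<^sup>2 * 2) / (S0 * (S0 + L)) < 2 * Q"
    by (simp only: pos_divide_less_eq)
  thus "(S0 - L) / S0 < 2 * Q"
    unfolding diff by (simp add: mult.commute mult.left_commute)
  have S0_le: "S0 \<le> L * (1 + 2 * Q)"
    unfolding S0_def using assms Q Q_pos
    by (intro real_le_lsqrt) (auto simp: power2_eq_square algebra_simps)
  show "Q * (1 - 2 * Q) < (S0 - L) / (S0 + L)"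
  proof -
    have e: "(S0 - L) / (S0 + L) = Q * (2 * L / (S0 + L))\<^sup>2"
      unfolding diff by (simp add: power2_eq_square)
    have "S0 + L \<le> 2 * L * (1 + Q)" using S0_le by (simp add: algebra_simps)
    hence "2 * L / (2 * L * (1 + Q)) \<le> 2 * L / (S0 + L)"
      using gt assms(1) Q_pos by (intro divide_left_mono mult_pos_pos) simp_all
    hence "1 / (1 + Q) \<le> 2 * L / (S0 + L)" using assms(1) by simp
    hence "(1 / (1 + Q))\<^sup>2 \<le> (2 * L / (S0 + L))\<^sup>2"
      using Q_pos by (intro power_mono) auto
    moreover have "1 - 2 * Q < (1 / (1 + Q))\<^sup>2"
    proof -
      have "(1 - 2 * Q) * (1 + Q)\<^sup>2 = 1 - (3 * Q\<^sup>2 + 2 * Q ^ 3)"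
        by (simp add: power2_eq_square power3_eq_cube algebra_simps)
      also have "\<dots> < 1"
      proof -
        have "3 * Q\<^sup>2 > 0" "2 * Q ^ 3 > 0" using Q_pos by simp_all
        thus ?thesis by linarith
      qed
      finally show ?thesis using Q_pos by (simp add: power_divide pos_less_divide_eq)
    qed
    ultimately show ?thesis unfolding e using Q_pos by simp
  qed
qed

text \<open>
  The hypothesis \<open>e > 0\<close> is separate from \<open>Q (1 - 2 Q) < e\<close> because \<open>Q (1 - 2 Q)\<close> need not be
  positive; for \<open>Q \<ge> 1 / 2\<close> the lower bound on \<open>\<rho> - 1\<close> is trivial.
\<close>

lemma sqrt_perturbation_bounds:
  fixes \<rho> lam Q e e' :: real
  assumes "\<rho> > 0" "lam > 0" "Q > 0" "e > 0"
    and low: "1 + lam * e \<le> \<rho>\<^sup>2" and e: "Q * (1 - 2 * Q) < e"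
    and high: "\<rho>\<^sup>2 \<le> 1 + lam * e'" and e': "e' < 2 * Q"
  shows "\<rho> > 1" and "(1 / 2 - Q) / (1 + 1 / 32 * lam) * lam * Q < \<rho> - 1" and "\<rho> - 1 < lam * Q"
proof -
  have "1\<^sup>2 < \<rho>\<^sup>2" using low mult_pos_pos[OF assms(2,4)] by simp
  thus gt1: "\<rho> > 1" using assms(1) by (intro power2_less_imp_less[of 1]) auto
  have "lam * e' < lam * (2 * Q)" using e' assms(2) by simp
  hence "\<rho>\<^sup>2 < (1 + lam * Q)\<^sup>2"
    using high zero_le_power2[of "lam * Q"] by (simp add: power2_eq_square algebra_simps)
  hence "\<rho> < 1 + lam * Q" using assms by (intro power2_less_imp_less[of \<rho>]) auto
  thus "\<rho> - 1 < lam * Q" by simp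
  define u where "u = lam * (Q * (1 - 2 * Q))"
  define c where "c = 1 / 32 * lam"
  have c: "c > 0" using assms by (simp add: c_def)
  have "Q * (1 - 2 * Q) = 1 / 8 - 2 * (Q - 1 / 4)\<^sup>2"
    by (simp add: power2_eq_square algebra_simps)
  hence "Q * (1 - 2 * Q) \<le> 1 / 8" by simp
  hence "lam * (Q * (1 - 2 * Q)) \<le> lam * (1 / 8)" using assms(2) by (intro mult_left_mono) auto
  hence uc: "u \<le> 4 * c" by (simp add: u_def c_def)
  have u_less: "1 + u < \<rho>\<^sup>2"
    using low mult_strict_left_mono[OF e assms(2)] by (simp add: u_def)
  have "1 + (u / 2) / (1 + c) < \<rho>"
  proof (cases "u \<le> 0")
    case True
    hence "(u / 2) / (1 + c) \<le> 0" using c by (simp add: divide_nonpos_pos)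
    thus ?thesis using gt1 by simp
  next
    case False
    define s where "s = u / (1 + c)"
    have s: "s \<ge> 0" "u = s * (1 + c)" using False c by (auto simp: s_def)
    \<comment> \<open>With \<open>u = s (1 + c)\<close>, the inequality \<open>(1 + s / 2)\<^sup>2 \<le> 1 + u\<close> amounts to \<open>s \<le> 4 c\<close>.\<close>
    have "s * (1 + c) \<le> 4 * c * (1 + c)"
      using uc s c by (smt (verit) mult_less_cancel_left2 mult_pos_pos)
    hence "s \<le> 4 * c" using c by simp
    hence "s * s \<le> s * (4 * c)" using s by (intro mult_left_mono) auto
    hence "(1 + s / 2)\<^sup>2 \<le> 1 + u" using s(2) by (simp add: power2_eq_square algebra_simps)
    hence "(1 + s / 2)\<^sup>2 < \<rho>\<^sup>2" using u_less by simp
    hence "1 + s / 2 < \<rho>" using assms(1) by (intro power2_less_imp_less[of _ \<rho>]) auto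
    moreover have "(u / 2) / (1 + c) = s / 2" by (simp add: s_def)
    ultimately show ?thesis by (simp only:)
  qed
  moreover have "(1 / 2 - Q) / (1 + 1 / 32 * lam) * lam * Q = (u / 2) / (1 + c)"
  proof -
    have "u / 2 = (1 / 2 - Q) * lam * Q" by (simp add: u_def field_simps)
    thus ?thesis by (simp add: c_def)
  qed
  ultimately show "(1 / 2 - Q) / (1 + 1 / 32 * lam) * lam * Q < \<rho> - 1"
    by (simp only: less_diff_eq add.commute)
qed

theorem theorem2:
  fixes m \<sigma> L0 L y0 P R :: real and y :: "real \<Rightarrow> real"
  assumes "m > 0" and "\<sigma> > 0" and "0 < L0" and "L0 < L" and "y0 > 0"
    and "wire_motion m \<sigma> L0 L y0 y"
    and "is_least_period P y"
    and "R = (P - rayleigh_period m \<sigma> L0 L) / P"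
  shows "\<exists>\<Theta>::real.
           \<bar>R\<bar> = \<Theta> * (L0 / (L - L0)) * (y0 / (2 * L))\<^sup>2 \<and>
           (1 / 2 - (y0 / (2 * L))\<^sup>2) / (1 + 1 / 32 * (L0 / (L - L0))) \<le> \<Theta> \<and> \<Theta> \<le> 1 \<and>
           (1 / 2 - (y0 / (2 * L))\<^sup>2) / (1 + 1 / 32 * (L0 / (L - L0))) < \<Theta> \<and> \<Theta> < 1"
proof -
  define S0 where "S0 = sqrt (L\<^sup>2 + y0\<^sup>2)"
  define \<rho> where "\<rho> = rayleigh_period m \<sigma> L0 L / P"
  define lam where "lam = L0 / (L - L0)"
  define Q where "Q = (y0 / (2 * L))\<^sup>2"
  define \<Theta> where "\<Theta> = (\<rho> - 1) / (lam * Q)"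
  have L: "L > 0" and lam: "lam > 0" and Q: "Q > 0" using assms by (auto simp: lam_def Q_def)
  have lamQ: "lam * Q > 0" using lam Q by simp
  note ratio = period_ratio_bounds[OF assms(1-7), folded S0_def \<rho>_def lam_def]
  note el = elongation_bounds[OF L assms(5), folded S0_def Q_def]
  have "(S0 - L) / (S0 + L) > 0" using el(1) L by simp
  note bounds = sqrt_perturbation_bounds[OF ratio(1) lam Q this ratio(2) el(3) ratio(3) el(2)]
  have "P > 0" using assms(7) by (simp add: is_least_period_def is_period_def)
  hence "R = 1 - \<rho>" by (simp add: assms(8) \<rho>_def diff_divide_distrib)
  hence "\<bar>R\<bar> = \<Theta> * lam * Q" using bounds(1) lam Q by (simp add: \<Theta>_def)
  moreover have "\<Theta> < 1" using bounds(3) lamQ by (simp add: \<Theta>_def)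
  moreover have "(1 / 2 - Q) / (1 + 1 / 32 * lam) < \<Theta>"
    using bounds(2) lamQ unfolding \<Theta>_def by (simp only: pos_less_divide_eq mult.assoc)
  ultimately show ?thesis
    unfolding lam_def[symmetric] Q_def[symmetric] by (intro exI[of _ \<Theta>]) auto
qed

end
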